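(* The following exact values hold: $$\operatorname{gp}(C_s\boxtimes C_t)=10\quad\text{for } (s,t)\in\{(7,7),(7,9),(7,11),(9,9),(10,10)\},$$ $$\operatorname{gp}(C_s\boxtimes C_t)=11\quad\text{for } s=11\text{ and } t\in\{11,13,15,17,19,21,22\},$$ and the same values hold with $s$ and $t$ interchanged.
   Context: All graphs are finite, simple and connected. $d_G(u,v)$ is the usual shortest-path distance in $G$. A set $S\subseteq V(G)$ is a general position set of $G$ if no vertex of $S$ lies on a shortest path between two other vertices of $S$; equivalently, $d_G(u,v)\ne d_G(u,w)+d_G(w,v)$ for all pairwise distinct $u,v,w\in S$. The general position number $\operatorname{gp}(G)$ is the maximum cardinality of a general position set of $G$. The strong product $G\boxtimes H$ has vertex set $V(G)\times V(H)$; distinct vertices $(u_x,u_y)$ and $(v_x,v_y)$ are adjacent if and only if ($u_x=v_x$ and $u_yv_y\in E(H)$), or ($u_y=v_y$ and $u_xv_x\in E(G)$), or ($u_xv_x\in E(G)$ and $u_yv_y\in E(H)$). $C_n$ is the cycle on $n$ vertices. *)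

theory Defs
  imports "Graph_Theory.Graph_Theory"
begin

text \<open>
  Graphs are records with a vertex set and a set of arcs; a finite simple graph is one satisfying
  \<^locale>\<open>pair_graph\<close>, where each edge is represented by its two opposite arcs.
\<close>

text \<open>
  For \<open>n \<ge> 3\<close> this is the cycle on the vertices \<open>0, \<dots>, n - 1\<close>.
  For smaller \<open>n\<close> it is not a cycle (and not even loop-free for \<open>n = 1\<close>).
\<close>
definition cycle_graph :: "nat \<Rightarrow> nat pair_pre_digraph" where
  "cycle_graph n =
    \<lparr> pverts = {..<n},
      parcs = {(i, j). i < n \<and> j < n \<and> (j = (i + 1) mod n \<or> i = (j + 1) mod n)} \<rparr>"

definition strong_product ::
  "'a pair_pre_digraph \<Rightarrow> 'b pair_pre_digraph \<Rightarrow> ('a \<times> 'b) pair_pre_digraph" where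
  "strong_product G H =
    \<lparr> pverts = pverts G \<times> pverts H,
      parcs = {((ux, uy), (vx, vy)).
        (ux, uy) \<in> pverts G \<times> pverts H \<and> (vx, vy) \<in> pverts G \<times> pverts H \<and>
        (ux = vx \<and> (uy, vy) \<in> parcs H \<or>
         uy = vy \<and> (ux, vx) \<in> parcs G \<or>
         (ux, vx) \<in> parcs G \<and> (uy, vy) \<in> parcs H)} \<rparr>"

text \<open>
  The least length of a walk, obtained from the library's weighted distance with unit weights.
  It is infinite for vertices that are not connected by a walk.
\<close>
definition graph_dist :: "'a pair_pre_digraph \<Rightarrow> 'a \<Rightarrow> 'a \<Rightarrow> ereal" where
  "graph_dist G u v = wf_digraph.\<mu> (with_proj G) (\<lambda>_. 1) u v"

definition general_position_set :: "'a pair_pre_digraph \<Rightarrow> 'a set \<Rightarrow> bool" where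
  "general_position_set G S \<longleftrightarrow> S \<subseteq> pverts G \<and>
    (\<forall>u\<in>S. \<forall>v\<in>S. \<forall>w\<in>S. u \<noteq> v \<longrightarrow> u \<noteq> w \<longrightarrow> v \<noteq> w \<longrightarrow>
      graph_dist G u v \<noteq> graph_dist G u w + graph_dist G w v)"

text \<open>For a finite graph the maximum is over a finite set, nonempty because of \<open>S = {}\<close>.\<close>
definition gp :: "'a pair_pre_digraph \<Rightarrow> nat" where
  "gp G = Max (card ` {S. general_position_set G S})"

lemma pair_graph_cycle_graph:
  assumes "n \<ge> 3"
  shows "pair_graph (cycle_graph n)"
proof -
  have "finite (parcs (cycle_graph n))"
    by (rule finite_subset[of _ "{..<n} \<times> {..<n}"]) (auto simp: cycle_graph_def)
  moreover have "(i + 1) mod n \<noteq> i" if "i < n" for i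
    using that assms by (cases "i + 1 = n") auto
  ultimately show ?thesis
    by unfold_locales (fastforce simp: cycle_graph_def symmetric_def intro!: symI)+
qed

lemma pair_graph_strong_product:
  assumes "pair_graph G" and "pair_graph H"
  shows "pair_graph (strong_product G H)"
proof -
  interpret G: pair_graph G by fact
  interpret H: pair_graph H by fact
  have "finite (parcs (strong_product G H))"
    by (rule finite_subset[of _ "(pverts G \<times> pverts H) \<times> (pverts G \<times> pverts H)"])
      (auto simp: strong_product_def)
  moreover have "(v, u) \<in> parcs G" if "(u, v) \<in> parcs G" for u v
    using that G.arcs_symmetric by blast
  moreover have "(v, u) \<in> parcs H" if "(u, v) \<in> parcs H" for u v
    using that H.arcs_symmetric by blast
  ultimately show ?thesis
    by unfold_locales
      (auto simp: strong_product_def symmetric_def intro!: symI dest: G.no_loops H.no_loops)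
qed

end

theory Submission
  imports Defs
begin

text \<open>
  The distance in the strong product of \<open>C\<^sub>s\<close> and \<open>C\<^sub>t\<close> is the maximum of the two cycle distances
  (\<open>graph_dist_torus\<close>), so each pair of points has a coordinate that determines its distance.

  For the upper bound, take \<open>s div 2 + 1\<close> consecutive columns of the torus. They are an isometric path
  times \<open>C\<^sub>t\<close>, and such a strip holds at most six points of a general position set
  (\<open>card_strip_le_6\<close>): the pairs whose distance is determined by the path coordinate form a partial
  order without chains of three elements, so the points split into two antichains; on an antichain
  the distance is that of \<open>C\<^sub>t\<close>, where four points are never in general position
  (\<open>four_on_cycle_between\<close>). Averaging over all \<open>s\<close> positions of the strip gives
  \<open>(s div 2 + 1) * card S \<le> 6 * s\<close> (\<open>torus_general_position_bound\<close>), hence at most \<open>10\<close> points for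
  \<open>s \<in> {7, 9, 10}\<close> and at most \<open>11\<close> for \<open>s = 11\<close>, for every \<open>t\<close> in question.

  The bound is attained by evenly spaced points on a closed curve that winds once around the first
  cycle and three or four times around the second (\<open>winding\<close>). Whichever coordinate determines the
  distance of two such points, they differ there by more than a quarter turn up to rounding, which
  leaves no room for a third point between them on a shortest path. As rounding matters for these
  small cycles, the finitely many cases are verified by computation.
\<close>

section \<open>Distances in cycles and their strong products\<close>

definition cycle_dist :: "nat \<Rightarrow> nat \<Rightarrow> nat \<Rightarrow> nat" where
  "cycle_dist n i j = min ((i - j) + (j - i)) (n - ((i - j) + (j - i)))"

definition torus_dist :: "nat \<Rightarrow> nat \<Rightarrow> nat \<times> nat \<Rightarrow> nat \<times> nat \<Rightarrow> nat" where
  "torus_dist s t u v = max (cycle_dist s (fst u) (fst v)) (cycle_dist t (snd u) (snd v))"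

text \<open>
  A potential that vanishes at the target and drops by at most one along an arc bounds the length of
  every walk from below; if some arc lowers it at every other vertex, following such arcs gives a
  walk that attains the bound.
\<close>
lemma graph_dist_eq_potential:
  fixes f :: "'a \<Rightarrow> nat"
  assumes "pair_graph G" and "u \<in> pverts G" and "v \<in> pverts G"
    and zero: "f v = 0"
    and lipschitz: "\<And>a b. (a, b) \<in> parcs G \<Longrightarrow> f a \<le> Suc (f b)"
    and descent: "\<And>a. a \<in> pverts G \<Longrightarrow> a \<noteq> v \<Longrightarrow> \<exists>b. (a, b) \<in> parcs G \<and> f b < f a"
  shows "graph_dist G u v = ereal (real (f u))"
proof -
  interpret pair_graph G by fact
  have lower: "real (f a) \<le> awalk_cost (\<lambda>_. 1) p" if "awalk a p v" for a p
    using that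
  proof (induction p arbitrary: a)
    case Nil
    then show ?case by (simp add: awalk_Nil_iff zero)
  next
    case (Cons e p)
    then have "(a, snd e) \<in> parcs G" and "awalk (snd e) p v"
      by (auto simp: awalk_Cons_iff)
    from lipschitz[OF this(1)] Cons.IH[OF this(2)] show ?case by simp
  qed
  have upper: "\<exists>p. awalk a p v \<and> awalk_cost (\<lambda>_. 1) p \<le> real (f a)" if "a \<in> pverts G" for a
    using that
  proof (induction "f a" arbitrary: a rule: less_induct)
    case less
    show ?case
    proof (cases "a = v")
      case True
      then show ?thesis using less.prems by (intro exI[of _ "[]"]) (simp add: awalk_Nil_iff)
    next
      case False
      then obtain b where b: "(a, b) \<in> parcs G" "f b < f a"
        using descent less.prems by blast
      then have "b \<in> pverts G" using in_arcsD2 by blast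
      then obtain p where p: "awalk b p v" "awalk_cost (\<lambda>_. 1) p \<le> real (f b)"
        using less.hyps b(2) by blast
      have "awalk a ((a, b) # p) v"
        using b(1) p(1) less.prems by (simp add: awalk_Cons_iff)
      moreover have "awalk_cost (\<lambda>_. 1) ((a, b) # p) \<le> real (f a)"
        using b(2) p(2) by simp
      ultimately show ?thesis by blast
    qed
  qed
  have "\<mu> (\<lambda>_. 1) u v = ereal (real (f u))"
  proof (rule antisym)
    obtain p where "awalk u p v" "awalk_cost (\<lambda>_. 1) p \<le> real (f u)"
      using upper \<open>u \<in> pverts G\<close> by blast
    then show "\<mu> (\<lambda>_. 1) u v \<le> ereal (real (f u))"
      using min_cost_le_walk_cost[of u p v "\<lambda>_. 1"] by (meson ereal_less_eq(3) order_trans)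
    show "ereal (real (f u)) \<le> \<mu> (\<lambda>_. 1) u v"
      unfolding \<mu>_def by (rule INF_greatest) (use lower in simp)
  qed
  then show ?thesis by (simp add: graph_dist_def)
qed

lemma cycle_dist_eq_0_iff:
  "i < n \<Longrightarrow> j < n \<Longrightarrow> cycle_dist n i j = 0 \<longleftrightarrow> i = j"
  by (auto simp: cycle_dist_def min_def)

lemma cycle_dist_commute: "cycle_dist n i j = cycle_dist n j i"
  by (simp add: cycle_dist_def add.commute)

lemma cycle_dist_triangle:
  assumes "i < n" and "j < n" and "k < n"
  shows "cycle_dist n i k \<le> cycle_dist n i j + cycle_dist n j k"
proof -
  define x y z where "x = (i - j) + (j - i)" and "y = (j - k) + (k - j)" and "z = (i - k) + (k - i)"
  have "z \<le> x + y" "y \<le> x + z" "x \<le> z + y"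
    unfolding x_def y_def z_def by simp_all
  moreover have "x < n" "y < n" "z < n" "x + y + z \<le> 2 * n"
    using assms unfolding x_def y_def z_def by simp_all
  ultimately have "min z (n - z) \<le> min x (n - x) + min y (n - y)"
    by (auto simp: min_def)
  then show ?thesis by (simp add: cycle_dist_def x_def y_def z_def)
qed

lemma in_arcs_cycle_graph_iff:
  "(i, j) \<in> parcs (cycle_graph n) \<longleftrightarrow> i < n \<and> j < n \<and>
    (j = Suc i \<or> i = Suc j \<or> (i = 0 \<and> Suc j = n) \<or> (j = 0 \<and> Suc i = n))"
proof -
  have *: "(a = Suc b mod n) \<longleftrightarrow> (a = Suc b \<or> (a = 0 \<and> Suc b = n))"
    if "a < n" "b < n" for a b
    using that by (cases "Suc b = n") auto
  show ?thesis
    by (simp add: cycle_graph_def * cong: conj_cong) metis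
qed

lemma cycle_dist_arc:
  assumes "(i, j) \<in> parcs (cycle_graph n)" and "k < n"
  shows "cycle_dist n i k \<le> Suc (cycle_dist n j k)"
proof -
  have "i < n" "j < n" "cycle_dist n i j \<le> 1"
    using assms(1) by (auto simp: in_arcs_cycle_graph_iff cycle_dist_def)
  then show ?thesis
    using cycle_dist_triangle[of i n j k] assms(2) by simp
qed

text \<open>
  A shortest path to \<open>k\<close> may rest in a factor where it has already arrived. Allowing the step to stay
  at \<open>i\<close> when \<open>i = k\<close>, where truncated subtraction keeps the distance at \<open>0\<close>, lets the two factors of
  a product move independently.
\<close>
lemma cycle_step_towards:
  assumes "i < n" and "k < n"
  obtains j where "j < n" and "j = i \<or> (i, j) \<in> parcs (cycle_graph n)"
    and "cycle_dist n j k = cycle_dist n i k - 1"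
proof -
  define succ where "succ = (if Suc i = n then 0 else Suc i)"
  define pred where "pred = (if i = 0 then n - 1 else i - 1)"
  consider "i = k" | "i < k" "2 * (k - i) \<le> n" | "i < k" "n < 2 * (k - i)"
    | "k < i" "2 * (i - k) \<le> n" | "k < i" "n < 2 * (i - k)"
    by linarith
  then consider "i = k" | "cycle_dist n succ k = cycle_dist n i k - 1"
    | "cycle_dist n pred k = cycle_dist n i k - 1"
  proof cases
    case 1
    then show ?thesis using that(1) by simp
  next
    case 2
    then have "succ = Suc i" using assms by (simp add: succ_def)
    then have "cycle_dist n succ k = cycle_dist n i k - 1" using 2 by (simp add: cycle_dist_def)
    then show ?thesis by (rule that(2))
  next
    case 3
    then have "cycle_dist n pred k = cycle_dist n i k - 1"
      using assms by (cases i) (simp_all add: cycle_dist_def pred_def)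
    then show ?thesis by (rule that(3))
  next
    case 4
    then have "cycle_dist n pred k = cycle_dist n i k - 1"
      by (cases i) (simp_all add: cycle_dist_def pred_def)
    then show ?thesis by (rule that(3))
  next
    case 5
    then have "cycle_dist n succ k = cycle_dist n i k - 1"
      using assms by (cases "Suc i = n") (simp_all add: cycle_dist_def succ_def)
    then show ?thesis by (rule that(2))
  qed
  then show ?thesis
  proof cases
    case 1
    then show ?thesis using that[of i] assms by (simp add: cycle_dist_def)
  next
    case 2
    then show ?thesis using that[of succ] assms
      by (auto simp: in_arcs_cycle_graph_iff succ_def split: if_splits)
  next
    case 3
    then show ?thesis using that[of pred] assms
      by (auto simp: in_arcs_cycle_graph_iff pred_def split: if_splits)
  qed
qed

lemma pverts_torus:
  "pverts (strong_product (cycle_graph s) (cycle_graph t)) = {..<s} \<times> {..<t}"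
  by (simp add: strong_product_def cycle_graph_def)

text \<open>
  A step in the strong product can move both coordinates at once, so the coordinate that has farther
  to go alone determines the distance.
\<close>
lemma graph_dist_torus:
  assumes "s \<ge> 3" and "t \<ge> 3" and u: "u \<in> {..<s} \<times> {..<t}" and v: "v \<in> {..<s} \<times> {..<t}"
  shows "graph_dist (strong_product (cycle_graph s) (cycle_graph t)) u v
    = ereal (real (torus_dist s t u v))"
proof (rule graph_dist_eq_potential)
  let ?G = "strong_product (cycle_graph s) (cycle_graph t)"
  show "pair_graph ?G"
    using assms by (intro pair_graph_strong_product pair_graph_cycle_graph)
  show "u \<in> pverts ?G" and "v \<in> pverts ?G"
    using u v by (simp_all only: pverts_torus)
  show "torus_dist s t v v = 0"
    by (simp add: torus_dist_def cycle_dist_def)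
  show "torus_dist s t a v \<le> Suc (torus_dist s t b v)" if "(a, b) \<in> parcs ?G" for a b
  proof -
    have "fst a = fst b \<or> (fst a, fst b) \<in> parcs (cycle_graph s)"
      and "snd a = snd b \<or> (snd a, snd b) \<in> parcs (cycle_graph t)"
      using that by (auto simp: strong_product_def)
    then have "cycle_dist s (fst a) (fst v) \<le> Suc (cycle_dist s (fst b) (fst v))"
      and "cycle_dist t (snd a) (snd v) \<le> Suc (cycle_dist t (snd b) (snd v))"
      using cycle_dist_arc v by (auto simp: mem_Times_iff)
    then show ?thesis by (auto simp: torus_dist_def)
  qed
  show "\<exists>b. (a, b) \<in> parcs ?G \<and> torus_dist s t b v < torus_dist s t a v"
    if "a \<in> pverts ?G" and "a \<noteq> v" for a
  proof -
    obtain i j where a: "a = (i, j)" "i < s" "j < t"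
      using \<open>a \<in> pverts ?G\<close> unfolding pverts_torus by blast
    obtain k l where kl: "v = (k, l)" "k < s" "l < t"
      using v by auto
    obtain i' where i': "i' < s" "i' = i \<or> (i, i') \<in> parcs (cycle_graph s)"
      "cycle_dist s i' k = cycle_dist s i k - 1"
      using cycle_step_towards a kl by metis
    obtain j' where j': "j' < t" "j' = j \<or> (j, j') \<in> parcs (cycle_graph t)"
      "cycle_dist t j' l = cycle_dist t j l - 1"
      using cycle_step_towards a kl by metis
    have pos: "cycle_dist s i k \<noteq> 0 \<or> cycle_dist t j l \<noteq> 0"
      using that(2) a kl by (auto simp: cycle_dist_eq_0_iff)
    then have "i' \<noteq> i \<or> j' \<noteq> j"
      using i'(3) j'(3) by auto
    then have "(a, (i', j')) \<in> parcs ?G"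
      using a i' j' by (auto simp: strong_product_def cycle_graph_def)
    moreover have "torus_dist s t (i', j') v < torus_dist s t a v"
      using pos i'(3) j'(3) by (auto simp: torus_dist_def a kl)
    ultimately show ?thesis by blast
  qed
qed

lemma general_position_torus_iff:
  assumes "s \<ge> 3" and "t \<ge> 3"
  shows "general_position_set (strong_product (cycle_graph s) (cycle_graph t)) S \<longleftrightarrow>
    S \<subseteq> {..<s} \<times> {..<t} \<and>
    (\<forall>u\<in>S. \<forall>v\<in>S. \<forall>w\<in>S. u \<noteq> v \<longrightarrow> u \<noteq> w \<longrightarrow> v \<noteq> w \<longrightarrow>
      torus_dist s t u v \<noteq> torus_dist s t u w + torus_dist s t w v)"
proof (cases "S \<subseteq> {..<s} \<times> {..<t}")
  case True
  then have "graph_dist (strong_product (cycle_graph s) (cycle_graph t)) u v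
      = ereal (real (torus_dist s t u v))" if "u \<in> S" "v \<in> S" for u v
    using graph_dist_torus assms that by blast
  then show ?thesis
    using True unfolding general_position_set_def pverts_torus
    by (simp flip: of_nat_add)
next
  case False
  then show ?thesis by (simp add: general_position_set_def pverts_torus)
qed

lemma not_torus_between:
  assumes "general_position_set (strong_product (cycle_graph s) (cycle_graph t)) S"
    and "s \<ge> 3" and "t \<ge> 3" and "u \<in> S" "w \<in> S" "v \<in> S" "u \<noteq> v" "u \<noteq> w" "v \<noteq> w"
  shows "torus_dist s t u v \<noteq> torus_dist s t u w + torus_dist s t w v"
  using assms by (simp add: general_position_torus_iff)

lemma gp_torus_commute:
  assumes "s \<ge> 3" and "t \<ge> 3"
  shows "gp (strong_product (cycle_graph s) (cycle_graph t))
    = gp (strong_product (cycle_graph t) (cycle_graph s))"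
proof -
  let ?GP = "\<lambda>s t. {S. general_position_set (strong_product (cycle_graph s) (cycle_graph t)) S}"
  have sub: "card ` ?GP s t \<subseteq> card ` ?GP t s" if "s \<ge> 3" "t \<ge> 3" for s t
  proof
    fix k assume "k \<in> card ` ?GP s t"
    then obtain S where S: "S \<in> ?GP s t" "k = card S" by blast
    have "prod.swap ` S \<in> ?GP t s"
    proof -
      have swap: "torus_dist t s (prod.swap u) (prod.swap v) = torus_dist s t u v" for u v
        by (simp add: torus_dist_def max.commute)
      have "prod.swap ` S \<subseteq> {..<t} \<times> {..<s}"
        using S(1) that by (auto simp: general_position_torus_iff)
      then show ?thesis
        using S(1) that by (simp add: general_position_torus_iff swap inj_eq[OF inj_swap])
    qed
    moreover have "card (prod.swap ` S) = k"
      using S(2) by (simp add: card_image)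
    ultimately show "k \<in> card ` ?GP t s" by blast
  qed
  have "card ` ?GP s t = card ` ?GP t s"
    by (rule antisym) (rule sub, fact, fact)+
  then show ?thesis by (simp only: gp_def)
qed

section \<open>The upper bound\<close>

text \<open>
  Let \<open>a < b < c < d\<close>. The two arcs joining \<open>a\<close> to \<open>c\<close> contain \<open>b\<close> and \<open>d\<close> respectively, and one of
  them is a shortest path.
\<close>
lemma four_on_cycle_between:
  assumes "Y \<subseteq> {..<n}" and "card Y \<ge> 4"
  obtains u w v where "u \<in> Y" "w \<in> Y" "v \<in> Y" "u \<noteq> v" "u \<noteq> w" "v \<noteq> w"
    and "cycle_dist n u v = cycle_dist n u w + cycle_dist n w v"
proof -
  define ys where "ys = sorted_list_of_set Y"
  have fin: "finite Y" using assms(1) finite_subset by blast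
  then have set_ys: "set ys = Y" and len: "length ys \<ge> 4" and srt: "sorted_wrt (<) ys"
    using assms(2) by (simp_all add: ys_def)
  define a b c d where "a = ys ! 0" and "b = ys ! 1" and "c = ys ! 2" and "d = ys ! 3"
  have ord: "a < b" "b < c" "c < d"
    using srt len unfolding a_def b_def c_def d_def by (simp_all add: sorted_wrt_iff_nth_less)
  have mem: "a \<in> Y" "b \<in> Y" "c \<in> Y" "d \<in> Y"
    unfolding a_def b_def c_def d_def set_ys[symmetric] by (rule nth_mem, use len in linarith)+
  then have "d < n" using assms(1) by blast
  have "cycle_dist n a c = cycle_dist n a b + cycle_dist n b c \<or>
      cycle_dist n a c = cycle_dist n a d + cycle_dist n d c"
  proof (cases "2 * (c - a) \<le> n")
    case True
    then show ?thesis using ord by (simp add: cycle_dist_def)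
  next
    case False
    then show ?thesis using ord \<open>d < n\<close> by (simp add: cycle_dist_def)
  qed
  then show ?thesis
  proof
    assume "cycle_dist n a c = cycle_dist n a b + cycle_dist n b c"
    then show ?thesis using that[of a b c] ord mem by simp
  next
    assume "cycle_dist n a c = cycle_dist n a d + cycle_dist n d c"
    then show ?thesis using that[of a d c] ord mem by simp
  qed
qed

text \<open>
  If the second coordinate dominates every distance within \<open>A\<close>, then \<open>A\<close> projects injectively to a
  general position set of the cycle \<open>C\<^sub>t\<close>.
\<close>
lemma card_vertical_le_3:
  assumes "s \<ge> 3" and "t \<ge> 3"
    and gps: "general_position_set (strong_product (cycle_graph s) (cycle_graph t)) S"
    and "A \<subseteq> S"
    and vert: "\<And>u v. u \<in> A \<Longrightarrow> v \<in> A \<Longrightarrow> u \<noteq> v \<Longrightarrow>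
      cycle_dist s (fst u) (fst v) < cycle_dist t (snd u) (snd v)"
  shows "card A \<le> 3"
proof (rule ccontr)
  assume "\<not> card A \<le> 3"
  have "inj_on snd A"
  proof (rule inj_onI)
    fix u v assume "u \<in> A" "v \<in> A" "snd u = snd v"
    then show "u = v" using vert[of u v] by (auto simp: cycle_dist_def)
  qed
  then have card: "card (snd ` A) \<ge> 4"
    using \<open>\<not> card A \<le> 3\<close> by (simp add: card_image)
  have "S \<subseteq> {..<s} \<times> {..<t}"
    using gps assms(1,2) by (simp add: general_position_torus_iff)
  then have "snd ` A \<subseteq> {..<t}"
    using \<open>A \<subseteq> S\<close> by auto
  then obtain a b c where abc: "a \<in> snd ` A" "b \<in> snd ` A" "c \<in> snd ` A" "a \<noteq> c" "a \<noteq> b" "c \<noteq> b"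
    "cycle_dist t a c = cycle_dist t a b + cycle_dist t b c"
    using card by (rule four_on_cycle_between)
  then obtain u w v where uwv: "u \<in> A" "w \<in> A" "v \<in> A" "a = snd u" "b = snd w" "c = snd v"
    by blast
  then have *: "u \<noteq> v" "u \<noteq> w" "v \<noteq> w"
    using abc by auto
  moreover have "torus_dist s t x y = cycle_dist t (snd x) (snd y)"
    if "x \<in> A" "y \<in> A" "x \<noteq> y" for x y
    using vert[OF that] by (simp add: torus_dist_def)
  ultimately have "torus_dist s t u v = torus_dist s t u w + torus_dist s t w v"
    using abc(7) uwv by simp
  then show False
    using not_torus_between[OF gps assms(1,2)] uwv(1-3) * \<open>A \<subseteq> S\<close> by blast
qed

text \<open>
  On a strip whose first coordinates lie on an isometric path, with position \<open>p\<close> along it, say that \<open>u\<close>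
  is left of \<open>v\<close> if the path coordinate increases from \<open>u\<close> to \<open>v\<close> and determines their distance. By
  the triangle inequality for the other coordinate, in a chain \<open>u\<close>, \<open>v\<close>, \<open>w\<close> the middle point lies on
  a shortest path. Chains therefore have at most two elements, and the minimal elements and the
  remaining ones form two antichains. Distances within an antichain are dominated by the second
  coordinate.
\<close>
lemma card_strip_le_6:
  assumes "s \<ge> 3" and "t \<ge> 3"
    and gps: "general_position_set (strong_product (cycle_graph s) (cycle_graph t)) S"
    and "T \<subseteq> S"
    and path: "\<And>u v. u \<in> T \<Longrightarrow> v \<in> T \<Longrightarrow>
      cycle_dist s (fst u) (fst v) = (p u - p v) + (p v - p u)"
  shows "card T \<le> 6"
proof -
  define left where
    "left u v \<longleftrightarrow> p u < p v \<and> cycle_dist t (snd u) (snd v) \<le> p v - p u" for u v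
  define A where "A = {v \<in> T. \<forall>u\<in>T. \<not> left u v}"
  have S: "S \<subseteq> {..<s} \<times> {..<t}"
    using gps assms(1,2) by (simp add: general_position_torus_iff)
  have no_chain: "\<not> left v w" if "u \<in> T" "v \<in> T" "w \<in> T" "left u v" for u v w
  proof
    assume "left v w"
    have "{u, v, w} \<subseteq> {..<s} \<times> {..<t}" using that \<open>T \<subseteq> S\<close> S by blast
    then have "cycle_dist t (snd u) (snd w)
        \<le> cycle_dist t (snd u) (snd v) + cycle_dist t (snd v) (snd w)"
      by (auto intro: cycle_dist_triangle)
    then have "torus_dist s t u w = torus_dist s t u v + torus_dist s t v w"
      using that \<open>left v w\<close> by (auto simp: torus_dist_def left_def path)
    moreover have "u \<noteq> v" "u \<noteq> w" "w \<noteq> v"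
      using that \<open>left v w\<close> by (auto simp: left_def)
    ultimately show False
      using not_torus_between[OF gps assms(1,2)] that \<open>T \<subseteq> S\<close> by blast
  qed
  have antichain: "card B \<le> 3"
    if "B \<subseteq> T" and "\<And>u v. u \<in> B \<Longrightarrow> v \<in> B \<Longrightarrow> \<not> left u v" for B
  proof (rule card_vertical_le_3[OF assms(1,2) gps])
    show "B \<subseteq> S" using that(1) \<open>T \<subseteq> S\<close> by blast
    fix u v assume uv: "u \<in> B" "v \<in> B" "u \<noteq> v"
    then have in_T: "u \<in> T" "v \<in> T" and not_left: "\<not> left u v" "\<not> left v u"
      using that by auto
    show "cycle_dist s (fst u) (fst v) < cycle_dist t (snd u) (snd v)"
    proof (cases "p u = p v")
      case True
      then have "cycle_dist s (fst u) (fst v) = 0" using path[OF in_T] by simp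
      moreover have "u \<in> {..<s} \<times> {..<t}" "v \<in> {..<s} \<times> {..<t}"
        using in_T \<open>T \<subseteq> S\<close> S by auto
      ultimately have "snd u \<noteq> snd v" and "cycle_dist t (snd u) (snd v) \<noteq> 0"
        using uv(3) by (auto simp: cycle_dist_eq_0_iff)
      then show ?thesis using \<open>cycle_dist s (fst u) (fst v) = 0\<close> by simp
    next
      case False
      then consider "p u < p v" | "p v < p u" by linarith
      then show ?thesis
        using not_left path[OF in_T] cycle_dist_commute[of t "snd u" "snd v"]
        by cases (simp_all add: left_def)
    qed
  qed
  have "card A \<le> 3"
    by (rule antichain) (auto simp: A_def)
  moreover have "card (T - A) \<le> 3"
  proof (rule antichain)
    fix v w assume "v \<in> T - A" "w \<in> T - A"
    then obtain u where "u \<in> T" "left u v" by (auto simp: A_def)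
    then show "\<not> left v w"
      using no_chain \<open>v \<in> T - A\<close> \<open>w \<in> T - A\<close> by blast
  qed blast
  moreover have "card T \<le> card A + card (T - A)"
    using card_Un_le[of A "T - A"] by (simp add: A_def Un_absorb1)
  ultimately show ?thesis by simp
qed

text \<open>
  Position of \<open>x\<close> on the cycle \<open>C\<^sub>s\<close> when counting starts at \<open>c\<close>, for \<open>c\<close> and \<open>x\<close> below \<open>s\<close>. The first
  \<open>s div 2 + 1\<close> positions form a longest isometric path.
\<close>
definition offset :: "nat \<Rightarrow> nat \<Rightarrow> nat \<Rightarrow> nat" where
  "offset s c x = (if c \<le> x then x - c else x + s - c)"

lemma offset_less: "c < s \<Longrightarrow> x < s \<Longrightarrow> offset s c x < s"
  by (cases "c \<le> x") (simp_all add: offset_def)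

text \<open>
  The starts of counting that give \<open>x\<close> an early position are counted by exchanging start and position.
\<close>
lemma offset_involution: "c < s \<Longrightarrow> x < s \<Longrightarrow> offset s (offset s c x) x = c"
  by (cases "c \<le> x") (simp_all add: offset_def)

lemma card_windows_containing:
  assumes "x < s" and "h < s"
  shows "card {c \<in> {..<s}. offset s c x \<le> h} = Suc h"
proof -
  have "bij_betw (\<lambda>k. offset s k x) {..h} {c \<in> {..<s}. offset s c x \<le> h}"
  proof (rule bij_betw_byWitness[where f' = "\<lambda>c. offset s c x"])
    show "(\<lambda>k. offset s k x) ` {..h} \<subseteq> {c \<in> {..<s}. offset s c x \<le> h}"
      using assms by (auto simp: offset_less offset_involution)
  qed (use assms in \<open>auto simp: offset_involution\<close>)
  then show ?thesis
    using bij_betw_same_card by fastforce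
qed

text \<open>
  Two vertices within the same window of length \<open>s div 2 + 1\<close> differ by at most half a turn, so the
  window is an isometric path.
\<close>
lemma cycle_dist_offset:
  assumes "c < s" "x < s" "y < s" "offset s c x \<le> s div 2" "offset s c y \<le> s div 2"
  shows "cycle_dist s x y
    = (offset s c x - offset s c y) + (offset s c y - offset s c x)"
proof -
  define a b where "a = offset s c x" and "b = offset s c y"
  have "x = (if c + a < s then c + a else c + a - s)" "y = (if c + b < s then c + b else c + b - s)"
    using assms by (simp_all add: a_def b_def offset_def)
  moreover have "2 * a \<le> s" "2 * b \<le> s" "c < s"
    using assms by (simp_all add: a_def b_def)
  ultimately show ?thesis
    unfolding a_def[symmetric] b_def[symmetric]
    by (cases "c + a < s"; cases "c + b < s") (simp_all add: cycle_dist_def)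
qed

text \<open>
  Average over the \<open>s\<close> windows of \<open>s div 2 + 1\<close> consecutive columns: each contains at most six points
  of \<open>S\<close>, and each point lies in \<open>s div 2 + 1\<close> of them.
\<close>
lemma torus_general_position_bound:
  assumes "s \<ge> 3" and "t \<ge> 3"
    and gps: "general_position_set (strong_product (cycle_graph s) (cycle_graph t)) S"
  shows "Suc (s div 2) * card S \<le> 6 * s"
proof -
  have S: "S \<subseteq> {..<s} \<times> {..<t}"
    using gps assms(1,2) by (simp add: general_position_torus_iff)
  then have "finite S" by (rule finite_subset) simp
  let ?strip = "\<lambda>c. {u \<in> S. offset s c (fst u) \<le> s div 2}"
  have "(\<Sum>c<s. card (?strip c)) = Suc (s div 2) * card S"
  proof (rule sum_multicount)
    show "\<forall>u\<in>S. card {c \<in> {..<s}. offset s c (fst u) \<le> s div 2} = Suc (s div 2)"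
    proof
      fix u assume "u \<in> S"
      then have "fst u < s" using S by auto
      then show "card {c \<in> {..<s}. offset s c (fst u) \<le> s div 2} = Suc (s div 2)"
        using \<open>s \<ge> 3\<close> by (intro card_windows_containing) simp_all
    qed
  qed (use \<open>finite S\<close> in auto)
  moreover have "(\<Sum>c<s. card (?strip c)) \<le> (\<Sum>c<s. 6)"
  proof (rule sum_mono)
    fix c assume "c \<in> {..<s}"
    show "card (?strip c) \<le> 6"
    proof (rule card_strip_le_6[OF assms])
      fix u v assume "u \<in> ?strip c" "v \<in> ?strip c"
      moreover from this have "fst u < s" "fst v < s" using S by auto
      ultimately show "cycle_dist s (fst u) (fst v)
          = (offset s c (fst u) - offset s c (fst v)) + (offset s c (fst v) - offset s c (fst u))"
        using \<open>c \<in> {..<s}\<close> by (intro cycle_dist_offset) auto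
    qed simp
  qed
  ultimately show ?thesis by simp
qed

section \<open>The extremal sets\<close>

text \<open>
  General position of the points of a list, arranged for evaluation: each unordered pair is visited
  once, and the condition includes that the entries are distinct.
\<close>
definition torus_general_position :: "nat \<Rightarrow> nat \<Rightarrow> (nat \<times> nat) list \<Rightarrow> bool" where
  "torus_general_position s t P \<longleftrightarrow> set P \<subseteq> {..<s} \<times> {..<t} \<and>
    sorted_wrt (\<lambda>u v. u \<noteq> v \<and> (\<forall>w\<in>set P. w = u \<or> w = v \<or>
      torus_dist s t u v \<noteq> torus_dist s t u w + torus_dist s t w v)) P"

lemma torus_dist_commute: "torus_dist s t u v = torus_dist s t v u"
  by (simp add: torus_dist_def cycle_dist_commute[of s "fst u"] cycle_dist_commute[of t "snd u"])

lemma distinct_if_torus_general_position: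
  assumes "torus_general_position s t P"
  shows "distinct P"
proof -
  have "P ! i \<noteq> P ! j" if "i < j" "j < length P" for i j
    using assms that unfolding torus_general_position_def sorted_wrt_iff_nth_less by blast
  then show ?thesis
    unfolding distinct_conv_nth by (metis linorder_neqE_nat)
qed

lemma general_position_if_torus_general_position:
  assumes "s \<ge> 3" and "t \<ge> 3" and P: "torus_general_position s t P"
  shows "general_position_set (strong_product (cycle_graph s) (cycle_graph t)) (set P)"
proof -
  have ordered: "torus_dist s t (P ! i) (P ! j) \<noteq> torus_dist s t (P ! i) w + torus_dist s t w (P ! j)"
    if "i < j" "j < length P" "w \<in> set P" "w \<noteq> P ! i" "w \<noteq> P ! j" for i j w
    using P that unfolding torus_general_position_def sorted_wrt_iff_nth_less by blast
  have "torus_dist s t u v \<noteq> torus_dist s t u w + torus_dist s t w v"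
    if "u \<in> set P" "v \<in> set P" "w \<in> set P" "u \<noteq> v" "u \<noteq> w" "v \<noteq> w" for u v w
  proof -
    obtain i j where ij: "i < length P" "u = P ! i" "j < length P" "v = P ! j"
      using \<open>u \<in> set P\<close> \<open>v \<in> set P\<close> by (auto simp: in_set_conv_nth)
    then consider "i < j" | "j < i" using \<open>u \<noteq> v\<close> by (metis linorder_neqE_nat)
    then show ?thesis
    proof cases
      case 1
      then show ?thesis using ordered[of i j w] ij that by simp
    next
      case 2
      then have "torus_dist s t v u \<noteq> torus_dist s t v w + torus_dist s t w u"
        using ordered[of j i w] ij that by simp
      then show ?thesis
        by (simp add: torus_dist_commute[of s t v] torus_dist_commute[of s t w u] add.commute)
    qed
  qed
  then show ?thesis
    using P assms(1,2) by (simp add: general_position_torus_iff torus_general_position_def)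
qed

lemma gp_torus_eqI:
  assumes "s \<ge> 3" and "t \<ge> 3" and P: "torus_general_position s t P"
    and tight: "6 * s < Suc (s div 2) * Suc (length P)"
  shows "gp (strong_product (cycle_graph s) (cycle_graph t)) = length P"
  unfolding gp_def
proof (rule Max_eqI)
  let ?GP = "{S. general_position_set (strong_product (cycle_graph s) (cycle_graph t)) S}"
  have "?GP \<subseteq> Pow ({..<s} \<times> {..<t})"
    using assms(1,2) by (auto simp: general_position_torus_iff)
  then show "finite (card ` ?GP)"
    by (intro finite_imageI) (rule finite_subset, auto)
  show "k \<le> length P" if "k \<in> card ` ?GP" for k
  proof -
    have "Suc (s div 2) * k \<le> 6 * s"
      using that torus_general_position_bound[OF assms(1,2)] by blast
    with tight have "Suc (s div 2) * k < Suc (s div 2) * Suc (length P)"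
      by (rule le_less_trans[rotated])
    then show ?thesis by (simp only: mult_less_cancel1) linarith
  qed
  show "length P \<in> card ` ?GP"
    using general_position_if_torus_general_position[OF assms(1-3)]
      distinct_card[OF distinct_if_torus_general_position[OF P]]
    by (metis imageI mem_Collect_eq)
qed

text \<open>
  The points are evenly spaced, up to rounding, on a closed curve that winds once around the first
  cycle and \<open>a\<close> times around the second. In units of \<open>s / m\<close> and \<open>t / m\<close>, points whose indices differ
  cyclically by \<open>1, \<dots>, 5\<close> have coordinate distances \<open>(1, 3), (2, 4), (3, 1), (4, 2), (5, 5)\<close> for
  \<open>m = 10\<close>, \<open>a = 3\<close> and \<open>(1, 4), (2, 3), (3, 1), (4, 5), (5, 2)\<close> for \<open>m = 11\<close>, \<open>a = 4\<close>. If
  \<open>s \<le> t < 2 * s\<close>, or \<open>t = 2 * s\<close> and \<open>m = 11\<close>, then the coordinate that determines a distance always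
  is one where it amounts to at least three units. A point between two others would split a distance
  of at most half a turn, that is \<open>m / 2 < 6\<close> units, into two such parts. The offsets \<open>2\<close> and \<open>7\<close>
  are found by search: the small cases depend on the rounding, and these values suit all pairs
  \<open>(s, t)\<close> in question.
\<close>
definition winding :: "nat \<Rightarrow> nat \<Rightarrow> nat \<Rightarrow> nat \<Rightarrow> (nat \<times> nat) list" where
  "winding m a s t = map (\<lambda>i. ((i * s + 2) div m, (i * a * t + 7) div m mod t)) [0..<m]"

lemma length_winding: "length (winding m a s t) = m"
  by (simp add: winding_def)

text \<open>
  The quantifiers over the points are expanded before the distances are unfolded, so that every
  distance is simplified only on numerals.
\<close>
lemma winding_10_general_position:
  shows "torus_general_position 7 7 (winding 10 3 7 7)"
    and "torus_general_position 7 9 (winding 10 3 7 9)"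
    and "torus_general_position 7 11 (winding 10 3 7 11)"
    and "torus_general_position 9 9 (winding 10 3 9 9)"
    and "torus_general_position 10 10 (winding 10 3 10 10)"
  by (simp add: torus_general_position_def winding_def upt_rec;
      simp add: torus_dist_def cycle_dist_def)+

lemma winding_11_general_position:
  shows "torus_general_position 11 11 (winding 11 4 11 11)"
    and "torus_general_position 11 13 (winding 11 4 11 13)"
    and "torus_general_position 11 15 (winding 11 4 11 15)"
    and "torus_general_position 11 17 (winding 11 4 11 17)"
    and "torus_general_position 11 19 (winding 11 4 11 19)"
    and "torus_general_position 11 21 (winding 11 4 11 21)"
    and "torus_general_position 11 22 (winding 11 4 11 22)"
  by (simp add: torus_general_position_def winding_def upt_rec;
      simp add: torus_dist_def cycle_dist_def)+

theorem proposition4p6: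
  shows "(\<forall>(s, t) \<in> {(7, 7), (7, 9), (7, 11), (9, 9), (10, 10)}.
            gp (strong_product (cycle_graph s) (cycle_graph t)) = 10 \<and>
            gp (strong_product (cycle_graph t) (cycle_graph s)) = 10) \<and>
         (\<forall>t \<in> {11, 13, 15, 17, 19, 21, 22}.
            gp (strong_product (cycle_graph 11) (cycle_graph t)) = 11 \<and>
            gp (strong_product (cycle_graph t) (cycle_graph 11)) = 11)"
proof -
  have both: "gp (strong_product (cycle_graph s) (cycle_graph t)) = m \<and>
      gp (strong_product (cycle_graph t) (cycle_graph s)) = m"
    if "s \<ge> 3" "t \<ge> 3" "torus_general_position s t (winding m a s t)"
      "6 * s < Suc (s div 2) * Suc m" for s t m a
    using gp_torus_eqI[OF that(1-3)] that gp_torus_commute[of s t] by (simp add: length_winding)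
  have "gp (strong_product (cycle_graph s) (cycle_graph t)) = 10 \<and>
      gp (strong_product (cycle_graph t) (cycle_graph s)) = 10"
    if "(s, t) \<in> {(7, 7), (7, 9), (7, 11), (9, 9), (10, 10)}" for s t
  proof (rule both)
    show "torus_general_position s t (winding 10 3 s t)"
      using winding_10_general_position that by auto
    show "s \<ge> 3" "t \<ge> 3" "6 * s < Suc (s div 2) * Suc 10"
      using that by auto
  qed
  moreover have "gp (strong_product (cycle_graph 11) (cycle_graph t)) = 11 \<and>
      gp (strong_product (cycle_graph t) (cycle_graph 11)) = 11"
    if "t \<in> {11, 13, 15, 17, 19, 21, 22}" for t
  proof (rule both)
    show "torus_general_position 11 t (winding 11 4 11 t)"
      using winding_11_general_position that by auto
    show "t \<ge> 3"
      using that by auto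
  qed simp_all
  ultimately show ?thesis by blast
qed

end
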